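(* Let $\mathcal{H}=\mathcal{H}_1\otimes\mathcal{H}_2\otimes\mathcal{H}_3$ with $\dim\mathcal{H}_i=d_i$ and $A:=3-d_1-d_2-d_3-d_1d_2-d_1d_3-d_2d_3+3d_1d_2d_3$. The mean of the entangling power $\epsilon_1$ over the unitary group $U(d_1d_2d_3)$ with respect to the Haar measure is $$\langle\epsilon_1\rangle_{U(d_1d_2d_3)}=\frac{2A}{3(d_1d_2d_3+1)},$$ and the mean over the orthogonal group $O(d_1d_2d_3)$ (real orthogonal matrices in a fixed product basis) with respect to the Haar measure is $$\langle\epsilon_1\rangle_{O(d_1d_2d_3)}=\frac{2A\left(\left[\prod_{i=1}^3d_i(d_i+1)\right]-8\right)}{3(d_1d_2d_3-1)(d_1d_2d_3+2)\left[\prod_{i=1}^3(d_i+1)\right]}.$$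
   Context: For a pure state $|\psi\rangle\in\mathcal{H}$ and a bipartition $g|g'$ of $\{1,2,3\}$, $\tau_{g|g'}(|\psi\rangle)=2\big(1-\operatorname{tr}[(\operatorname{tr}_g|\psi\rangle\langle\psi|)^2]\big)$; one-tangle is $\tau_1=\frac13(\tau_{12|3}+\tau_{13|2}+\tau_{23|1})$. The entangling power $\epsilon_1(U)$ of a unitary $U$ on $\mathcal{H}$ is the average of $\tau_1(U|\psi_{\rm sep}\rangle)$ over $|\psi_{\rm sep}\rangle=|\psi_1\rangle\otimes|\psi_2\rangle\otimes|\psi_3\rangle$, each $|\psi_i\rangle$ drawn independently from the unitarily invariant measure on pure states of $\mathcal{H}_i$. *)

theory Defs
  imports "HOL-Probability.Probability"
begin

definition cmat_adj :: "complex^'n^'m \<Rightarrow> complex^'m^'n" where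
  "cmat_adj U = (\<chi> i j. cnj (U $ j $ i))"

definition unitary_mat :: "complex^'n^'n \<Rightarrow> bool" where
  "unitary_mat U \<longleftrightarrow> cmat_adj U ** U = mat 1"

definition cmat_of_real :: "real^'n^'m \<Rightarrow> complex^'n^'m" where
  "cmat_of_real Q = (\<chi> i j. complex_of_real (Q $ i $ j))"

definition haar_unitary :: "(complex^'n^'n) measure \<Rightarrow> bool" where
  "haar_unitary \<mu> \<longleftrightarrow> prob_space \<mu> \<and> sets \<mu> = sets borel \<and>
     (AE U in \<mu>. unitary_mat U) \<and>
     (\<forall>V. unitary_mat V \<longrightarrow> distr \<mu> borel (\<lambda>U. V ** U) = \<mu>)"

definition haar_orthogonal :: "(real^'n^'n) measure \<Rightarrow> bool" where
  "haar_orthogonal \<mu> \<longleftrightarrow> prob_space \<mu> \<and> sets \<mu> = sets borel \<and>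
     (AE Q in \<mu>. orthogonal_matrix Q) \<and>
     (\<forall>V. orthogonal_matrix V \<longrightarrow> distr \<mu> borel (\<lambda>Q. V ** Q) = \<mu>)"

definition unif_pure_states :: "(complex^'n) measure \<Rightarrow> bool" where
  "unif_pure_states \<nu> \<longleftrightarrow> prob_space \<nu> \<and> sets \<nu> = sets borel \<and>
     (AE x in \<nu>. norm x = 1) \<and>
     (\<forall>U. unitary_mat U \<longrightarrow> distr \<nu> borel (\<lambda>x. U *v x) = \<nu>)"

text \<open>H = H1 \<otimes> H2 \<otimes> H3 with the product basis indexed by 'a \<times> 'b \<times> 'c.\<close>

definition prod_state :: "complex^'a \<Rightarrow> complex^'b \<Rightarrow> complex^'c \<Rightarrow> complex^('a \<times> 'b \<times> 'c)" where
  "prod_state x y z = (\<chi> p. x $ fst p * y $ fst (snd p) * z $ snd (snd p))"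

text \<open>Reduced density matrices: rho1 = tr_{23} |psi><psi|, rho2 = tr_{13}, rho3 = tr_{12}.\<close>
definition rho1 :: "complex^('a::finite \<times> 'b::finite \<times> 'c::finite) \<Rightarrow> 'a \<Rightarrow> 'a \<Rightarrow> complex" where
  "rho1 \<psi> i i' = (\<Sum>j\<in>UNIV. \<Sum>k\<in>UNIV. \<psi> $ (i, j, k) * cnj (\<psi> $ (i', j, k)))"

definition rho2 :: "complex^('a::finite \<times> 'b::finite \<times> 'c::finite) \<Rightarrow> 'b \<Rightarrow> 'b \<Rightarrow> complex" where
  "rho2 \<psi> j j' = (\<Sum>i\<in>UNIV. \<Sum>k\<in>UNIV. \<psi> $ (i, j, k) * cnj (\<psi> $ (i, j', k)))"

definition rho3 :: "complex^('a::finite \<times> 'b::finite \<times> 'c::finite) \<Rightarrow> 'c \<Rightarrow> 'c \<Rightarrow> complex" where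
  "rho3 \<psi> k k' = (\<Sum>i\<in>UNIV. \<Sum>j\<in>UNIV. \<psi> $ (i, j, k) * cnj (\<psi> $ (i, j, k')))"

definition purity :: "('x::finite \<Rightarrow> 'x \<Rightarrow> complex) \<Rightarrow> real" where
  "purity \<rho> = Re (\<Sum>k\<in>UNIV. \<Sum>k'\<in>UNIV. \<rho> k k' * \<rho> k' k)"

definition tau_12_3 :: "complex^('a::finite \<times> 'b::finite \<times> 'c::finite) \<Rightarrow> real" where
  "tau_12_3 \<psi> = 2 * (1 - purity (rho3 \<psi>))"

definition tau_13_2 :: "complex^('a::finite \<times> 'b::finite \<times> 'c::finite) \<Rightarrow> real" where
  "tau_13_2 \<psi> = 2 * (1 - purity (rho2 \<psi>))"

definition tau_23_1 :: "complex^('a::finite \<times> 'b::finite \<times> 'c::finite) \<Rightarrow> real" where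
  "tau_23_1 \<psi> = 2 * (1 - purity (rho1 \<psi>))"

definition one_tangle :: "complex^('a::finite \<times> 'b::finite \<times> 'c::finite) \<Rightarrow> real" where
  "one_tangle \<psi> = (tau_12_3 \<psi> + tau_13_2 \<psi> + tau_23_1 \<psi>) / 3"

definition ent_power ::
  "(complex^'a) measure \<Rightarrow> (complex^'b) measure \<Rightarrow> (complex^'c) measure \<Rightarrow>
   complex^('a::finite \<times> 'b::finite \<times> 'c::finite)^('a \<times> 'b \<times> 'c) \<Rightarrow> real" where
  "ent_power \<nu>1 \<nu>2 \<nu>3 U =
     (\<integral>x. (\<integral>y. (\<integral>z. one_tangle (U *v prod_state x y z) \<partial>\<nu>3) \<partial>\<nu>2) \<partial>\<nu>1)"

end

theory Submission
  imports Defs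
begin

text \<open>
  For a fixed unit vector \<open>\<psi>\<close>, left invariance of the Haar measure makes \<open>U \<psi>\<close> an invariantly distributed
  random state. A fourth-moment tensor \<open>E[x\<^sub>p x\<^sub>q cnj x\<^sub>r cnj x\<^sub>s]\<close> invariant under real orthogonal
  matrices has the form
  \<open>\<alpha> \<delta>\<^sub>p\<^sub>q \<delta>\<^sub>r\<^sub>s + \<beta> (\<delta>\<^sub>p\<^sub>r \<delta>\<^sub>q\<^sub>s + \<delta>\<^sub>p\<^sub>s \<delta>\<^sub>q\<^sub>r)\<close>, which already follows from invariance
  under Householder reflections in at most two coordinates. Contracting the tensor in two ways
  determines \<open>\<alpha>\<close> and \<open>\<beta>\<close> from \<open>norm \<psi> = 1\<close> and \<open>s = |\<psi>\<^sup>T \<psi>|\<^sup>2\<close>; in the unitary case a phase change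
  gives \<open>\<alpha> = 0\<close>. The mean purities are linear in \<open>\<alpha>\<close> and \<open>\<beta>\<close>, and for product states \<open>s\<close> factorises
  with \<open>E |x\<^sup>T x|\<^sup>2 = 2 / (d + 1)\<close> in each factor.
\<close>

section \<open>Almost surely bounded Borel probability measures\<close>

text \<open>State distributions, Haar measures and their products all have this property. It is
  strong enough to make every continuous integrand integrable, so integrability reduces to
  continuity throughout.\<close>

definition bdd_prob :: "'a::euclidean_space measure \<Rightarrow> bool" where
  "bdd_prob M \<longleftrightarrow> prob_space M \<and> sets M = sets borel \<and> (\<exists>B. AE x in M. norm x \<le> B)"

text \<open>The measure is concentrated on a closed ball, which is compact in a Euclidean space. A
  continuous function is bounded there, and bounded measurable functions are integrable for a
  probability measure.\<close>

lemma bdd_prob_integrable: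
  fixes f :: "'a::euclidean_space \<Rightarrow> 'b::{banach, second_countable_topology}"
  assumes M: "bdd_prob M" and f: "continuous_on UNIV f"
  shows "integrable M f"
proof -
  interpret prob_space M using M by (simp add: bdd_prob_def)
  obtain B where B: "AE x in M. norm x \<le> B" using M by (auto simp: bdd_prob_def)
  have "compact (f ` cball 0 B)"
    by (intro compact_continuous_image continuous_on_subset[OF f]) auto
  then obtain C where C: "\<And>y. y \<in> f ` cball 0 B \<Longrightarrow> norm y \<le> C"
    using compact_imp_bounded bounded_iff by metis
  have "f \<in> borel_measurable M"
    using borel_measurable_continuous_onI[OF f] M by (simp add: bdd_prob_def cong: measurable_cong_sets)
  moreover have "AE x in M. norm (f x) \<le> C"
    using B by eventually_elim (auto intro!: C)
  ultimately show ?thesis by (intro integrable_const_bound)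
qed

text \<open>The Borel algebra of a product of Euclidean spaces is the product algebra, and the norm
  of a pair is at most the sum of the norms. The bounds of the factors therefore add up.\<close>

lemma bdd_prob_pair:
  fixes M1 :: "'a::euclidean_space measure" and M2 :: "'b::euclidean_space measure"
  assumes "bdd_prob M1" "bdd_prob M2"
  shows "bdd_prob (M1 \<Otimes>\<^sub>M M2)"
proof -
  interpret M1: prob_space M1 using assms by (simp add: bdd_prob_def)
  interpret M2: prob_space M2 using assms by (simp add: bdd_prob_def)
  interpret pair_prob_space M1 M2 ..
  have s: "sets M1 = sets borel" "sets M2 = sets borel" using assms by (auto simp: bdd_prob_def)
  have sets: "sets (M1 \<Otimes>\<^sub>M M2) = sets borel"
    using sets_pair_measure_cong[OF s] borel_prod[where ?'a='a and ?'b='b] by metis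
  obtain B1 where B1: "AE x in M1. norm x \<le> B1" using assms by (auto simp: bdd_prob_def)
  obtain B2 where B2: "AE x in M2. norm x \<le> B2" using assms by (auto simp: bdd_prob_def)
  have sp: "space (M1 \<Otimes>\<^sub>M M2) = UNIV" using sets_eq_imp_space_eq[OF sets] by simp
  have "AE p in M1 \<Otimes>\<^sub>M M2. norm p \<le> B1 + B2"
  proof (rule AE_pair_measure)
    show "{p \<in> space (M1 \<Otimes>\<^sub>M M2). norm p \<le> B1 + B2} \<in> sets (M1 \<Otimes>\<^sub>M M2)"
      unfolding sets sp by measurable
    show "AE x in M1. AE y in M2. norm (x, y) \<le> B1 + B2"
      using B1
    proof eventually_elim
      case (elim x)
      from B2 show ?case
      proof eventually_elim
        case (elim y)
        then show ?case using norm_Pair_le[of x y] \<open>norm x \<le> B1\<close> by linarith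
      qed
    qed
  qed
  then show ?thesis using sets P.prob_space_axioms by (auto simp: bdd_prob_def)
qed

lemma bdd_prob_fubini:
  fixes F :: "'a::euclidean_space \<Rightarrow> 'b::euclidean_space \<Rightarrow> 'c::{banach, second_countable_topology}"
  assumes "bdd_prob M1" "bdd_prob M2" "continuous_on UNIV (\<lambda>(x, y). F x y)"
  shows "(\<integral>p. F (fst p) (snd p) \<partial>(M1 \<Otimes>\<^sub>M M2)) = (\<integral>x. (\<integral>y. F x y \<partial>M2) \<partial>M1)"
    and "(\<integral>y. (\<integral>x. F x y \<partial>M1) \<partial>M2) = (\<integral>x. (\<integral>y. F x y \<partial>M2) \<partial>M1)"
proof -
  interpret M1: prob_space M1 using assms by (simp add: bdd_prob_def)
  interpret M2: prob_space M2 using assms by (simp add: bdd_prob_def)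
  interpret pair_prob_space M1 M2 ..
  have i: "integrable (M1 \<Otimes>\<^sub>M M2) (\<lambda>(x, y). F x y)"
    by (rule bdd_prob_integrable[OF bdd_prob_pair assms(3)]) (use assms in auto)
  show "(\<integral>p. F (fst p) (snd p) \<partial>(M1 \<Otimes>\<^sub>M M2)) = (\<integral>x. (\<integral>y. F x y \<partial>M2) \<partial>M1)"
    using integral_fst'[OF i] by (simp add: case_prod_beta')
  show "(\<integral>y. (\<integral>x. F x y \<partial>M1) \<partial>M2) = (\<integral>x. (\<integral>y. F x y \<partial>M2) \<partial>M1)"
    using Fubini_integral[OF i] .
qed

section \<open>Invariant random states and their fourth moments\<close>

text \<open>Invariance under real matrices acting on complex vectors is the common ground of both
  halves of the theorem: uniform pure states have it, and so do orbits of a complex unit vector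
  under the orthogonal group.\<close>

definition orth_inv_states :: "(complex^'n) measure \<Rightarrow> bool" where
  "orth_inv_states \<nu> \<longleftrightarrow> prob_space \<nu> \<and> sets \<nu> = sets borel \<and> (AE x in \<nu>. norm x = 1) \<and>
     (\<forall>V. orthogonal_matrix V \<longrightarrow> distr \<nu> borel (\<lambda>x. cmat_of_real V *v x) = \<nu>)"

text \<open>Purities are of degree two in the amplitudes and of degree two in their conjugates, so
  their means are linear in these numbers.\<close>

definition moment :: "(complex^'n) measure \<Rightarrow> 'n \<Rightarrow> 'n \<Rightarrow> 'n \<Rightarrow> 'n \<Rightarrow> complex" where
  "moment \<nu> p q r s = (\<integral>x. x $ p * x $ q * cnj (x $ r) * cnj (x $ s) \<partial>\<nu>)"

lemma unitary_cmat_of_real: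
  assumes "orthogonal_matrix V"
  shows "unitary_mat (cmat_of_real V)"
proof -
  have "(\<Sum>k\<in>UNIV. V $ k $ i * V $ k $ j) = (if i = j then 1 else 0)" for i j
    using assms by (simp add: orthogonal_matrix vec_eq_iff matrix_matrix_mult_def transpose_def mat_def)
  then show ?thesis
    by (simp add: unitary_mat_def cmat_adj_def cmat_of_real_def vec_eq_iff matrix_matrix_mult_def mat_def
        flip: of_real_mult of_real_sum)
qed

lemma unif_pure_states_orth_inv: "unif_pure_states \<nu> \<Longrightarrow> orth_inv_states \<nu>"
  by (simp add: unif_pure_states_def orth_inv_states_def unitary_cmat_of_real)

lemma orth_inv_states_bdd: "orth_inv_states \<nu> \<Longrightarrow> bdd_prob \<nu>"
  unfolding orth_inv_states_def bdd_prob_def by (auto intro!: exI[of _ 1] elim: eventually_mono)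

lemma continuous_mat_vec [continuous_intros]:
  fixes f :: "'t::topological_space \<Rightarrow> complex^'n^'m"
  assumes "continuous_on S f" "continuous_on S g"
  shows "continuous_on S (\<lambda>t. f t *v g t)"
  unfolding matrix_vector_mult_def
  by (intro continuous_on_vec_lambda continuous_intros assms)

lemma continuous_cmat_of_real [continuous_intros]:
  "continuous_on S f \<Longrightarrow> continuous_on S (\<lambda>t. cmat_of_real (f t))"
  unfolding cmat_of_real_def
  by (intro continuous_on_vec_lambda continuous_intros)

lemma borel_distr_integral:
  fixes f :: "'b::euclidean_space \<Rightarrow> 'c::{banach, second_countable_topology}"
  assumes "sets M = sets borel" "continuous_on UNIV T" "continuous_on UNIV f"
  shows "integral\<^sup>L (distr M borel T) f = (\<integral>x. f (T x) \<partial>M)"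
  using assms
  by (intro integral_distr)
     (auto intro!: borel_measurable_continuous_onI simp: measurable_cong_sets[OF assms(1) refl])

lemma moment_transform:
  assumes "sets \<nu> = sets borel" "distr \<nu> borel (\<lambda>x. U *v x) = \<nu>"
  shows "moment \<nu> p q r s =
    (\<integral>x. (U *v x) $ p * (U *v x) $ q * cnj ((U *v x) $ r) * cnj ((U *v x) $ s) \<partial>\<nu>)"
proof -
  have "moment \<nu> p q r s = moment (distr \<nu> borel (\<lambda>x. U *v x)) p q r s" using assms by simp
  then show ?thesis unfolding moment_def
    by (simp add: borel_distr_integral assms(1) continuous_intros)
qed

section \<open>Householder reflections\<close>

definition householder :: "real^'n \<Rightarrow> real^'n^'n" where
  "householder v = (\<chi> i j. of_bool (i = j) - 2 * v $ i * v $ j)"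

lemma orthogonal_householder:
  fixes v :: "real^'n"
  assumes "(\<Sum>k\<in>UNIV. (v $ k)\<^sup>2) = 1"
  shows "orthogonal_matrix (householder v)"
proof -
  have "(\<Sum>k\<in>UNIV. (of_bool (k = i) - 2 * v $ k * v $ i) * (of_bool (k = j) - 2 * v $ k * v $ j))
     = of_bool (i = j)" for i j
  proof -
    have "(\<Sum>k\<in>UNIV. (of_bool (k = i) - 2 * v $ k * v $ i) * (of_bool (k = j) - 2 * v $ k * v $ j))
      = (\<Sum>k\<in>UNIV. (if k = i then of_bool (i = j) - 2 * v $ i * v $ j else 0)
         - (if k = j then 2 * v $ j * v $ i else 0) + 4 * v $ i * v $ j * (v $ k)\<^sup>2)"
      by (intro sum.cong) (auto simp: algebra_simps power2_eq_square)
    also have "\<dots> = of_bool (i = j) - 2 * v $ i * v $ j - 2 * v $ j * v $ i + 4 * v $ i * v $ j * (\<Sum>k\<in>UNIV. (v $ k)\<^sup>2)"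
      unfolding sum.distrib sum_subtractf sum_distrib_left[symmetric] by simp
    finally show ?thesis using assms by simp
  qed
  then show ?thesis
    by (simp add: orthogonal_matrix vec_eq_iff matrix_matrix_mult_def transpose_def mat_def householder_def)
qed

lemma householder_mult:
  "(cmat_of_real (householder v) *v x) $ i
    = x $ i - 2 * of_real (v $ i) * (\<Sum>k\<in>UNIV. of_real (v $ k) * x $ k)"
proof -
  have "(cmat_of_real (householder v) *v x) $ i
     = (\<Sum>k\<in>UNIV. (if k = i then x $ i else 0) - 2 * of_real (v $ i) * (of_real (v $ k) * x $ k))"
    by (auto simp: matrix_vector_mult_def cmat_of_real_def householder_def algebra_simps intro!: sum.cong)
  also have "\<dots> = x $ i - 2 * of_real (v $ i) * (\<Sum>k\<in>UNIV. of_real (v $ k) * x $ k)"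
    unfolding sum_subtractf sum_distrib_left[symmetric] by simp
  finally show ?thesis .
qed

text \<open>A normal vector supported on two coordinates leaves all other coordinates fixed. Such
  reflections supply both coordinate swaps and genuine mixing of two coordinates.\<close>

lemma householder_two:
  fixes p q :: "'n::finite"
  assumes "p \<noteq> q" "a\<^sup>2 + b\<^sup>2 = 1"
  defines "v \<equiv> (\<chi> i. if i = p then a else if i = q then b else 0)"
  shows "orthogonal_matrix (householder v)"
    and "(cmat_of_real (householder v) *v x) $ i
      = x $ i - 2 * of_real (v $ i) * (of_real a * x $ p + of_real b * x $ q)"
proof -
  have "(\<Sum>k\<in>UNIV. (v $ k)\<^sup>2) = (\<Sum>k\<in>UNIV. (if k = p then a\<^sup>2 else 0) + (if k = q then b\<^sup>2 else 0))"
    using assms(1) by (intro sum.cong) (auto simp: v_def)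
  also have "\<dots> = 1" using assms(2) by (simp add: sum.distrib)
  finally show "orthogonal_matrix (householder v)" by (rule orthogonal_householder)
  have "(\<Sum>k\<in>UNIV. of_real (v $ k) * x $ k)
     = (\<Sum>k\<in>UNIV. (if k = p then of_real a * x $ p else 0) + (if k = q then of_real b * x $ q else 0))"
    using assms(1) by (intro sum.cong) (auto simp: v_def)
  then show "(cmat_of_real (householder v) *v x) $ i
      = x $ i - 2 * of_real (v $ i) * (of_real a * x $ p + of_real b * x $ q)"
    by (simp add: householder_mult sum.distrib)
qed

section \<open>Consequences of reflection invariance for the moments\<close>

lemma moment_integrable:
  "orth_inv_states \<nu> \<Longrightarrow> integrable \<nu> (\<lambda>x. x $ p * x $ q * cnj (x $ r) * cnj (x $ s))"
  by (intro bdd_prob_integrable orth_inv_states_bdd) (auto intro!: continuous_intros)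

lemma moment_commute:
  "moment \<nu> p q r s = moment \<nu> q p r s" "moment \<nu> p q r s = moment \<nu> p q s r"
  by (simp_all add: moment_def mult_ac)

text \<open>The reflection with normal vector \<open>e_k\<close> changes the sign of coordinate
  \<open>k\<close> alone. If \<open>k\<close> occurs an odd number of times among the four indices,
  the moment equals its own negative.\<close>

lemma moment_sign_flip:
  assumes \<nu>: "orth_inv_states \<nu>"
    and odd: "(if p = k then -1 else 1) * (if q = k then -1 else 1) * (if r = k then -1 else 1)
        * (if s = k then -1 else 1) = (-1 :: complex)"
  shows "moment \<nu> p q r s = 0"
proof -
  define v :: "real^'a" where "v = (\<chi> i. if i = k then 1 else 0)"
  have "(\<Sum>j\<in>UNIV. (v $ j)\<^sup>2) = 1" by (simp add: v_def if_distrib[of "\<lambda>t. t\<^sup>2"] cong: if_cong)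
  then have o: "orthogonal_matrix (householder v)" by (rule orthogonal_householder)
  have V: "(cmat_of_real (householder v) *v x) $ i = (if i = k then -1 else 1) * x $ i" for x i
    by (simp add: householder_mult v_def if_distrib[of complex_of_real] if_distrib[of "\<lambda>t. t * _"] cong: if_cong)
  have "moment \<nu> p q r s = (\<integral>x. ((if p = k then -1 else 1) * (if q = k then -1 else 1)
      * (if r = k then -1 else 1) * (if s = k then -1 else 1))
      * (x $ p * x $ q * cnj (x $ r) * cnj (x $ s)) \<partial>\<nu>)"
    using \<nu> o unfolding orth_inv_states_def
    by (subst moment_transform[of \<nu> "cmat_of_real (householder v)"]) (auto simp: V intro!: Bochner_Integration.integral_cong)
  also have "\<dots> = - moment \<nu> p q r s"
    unfolding odd moment_def by simp
  finally show ?thesis by simp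
qed

text \<open>If every index coincided with another one, the four would split into two equal pairs.
  Without such a pairing some index occurs exactly once, and flipping its sign kills the
  moment.\<close>

lemma moment_eq_0:
  assumes \<nu>: "orth_inv_states \<nu>"
    and "\<not> (p = q \<and> r = s)" "\<not> (p = r \<and> q = s)" "\<not> (p = s \<and> q = r)"
  shows "moment \<nu> p q r s = 0"
proof -
  consider "p \<noteq> q" "p \<noteq> r" "p \<noteq> s" | "q \<noteq> p" "q \<noteq> r" "q \<noteq> s" | "r \<noteq> p" "r \<noteq> q" "r \<noteq> s" | "s \<noteq> p" "s \<noteq> q" "s \<noteq> r"
    using assms(2-) by metis
  then show ?thesis
  proof cases
    case 1 then show ?thesis by (intro moment_sign_flip[OF \<nu>, where k=p]) auto
  next
    case 2 then show ?thesis by (intro moment_sign_flip[OF \<nu>, where k=q]) auto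
  next
    case 3 then show ?thesis by (intro moment_sign_flip[OF \<nu>, where k=r]) auto
  next
    case 4 then show ?thesis by (intro moment_sign_flip[OF \<nu>, where k=s]) auto
  qed
qed

text \<open>The reflection with normal vector \<open>(e_k - e_l) / sqrt 2\<close> exchanges the
  coordinates \<open>k\<close> and \<open>l\<close>.\<close>

lemma moment_transpose:
  fixes \<nu> :: "(complex^'n) measure"
  assumes \<nu>: "orth_inv_states \<nu>"
  defines "t \<equiv> Transposition.transpose"
  shows "moment \<nu> (t k l p) (t k l q) (t k l r) (t k l s) = moment \<nu> p q r s"
proof (cases "k = l")
  case True
  then show ?thesis by (simp add: t_def)
next
  case False
  define a where "a = 1 / sqrt (2::real)"
  have a: "a\<^sup>2 + (- a)\<^sup>2 = 1" "complex_of_real a * complex_of_real a = 1 / 2"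
    by (simp_all add: a_def power_divide flip: of_real_mult)
  let ?V = "householder (\<chi> i. if i = k then a else if i = l then - a else 0)"
  have V: "(cmat_of_real ?V *v x) $ i = x $ (t k l i)" for x i
  proof -
    have 1: "of_real a * (of_real a * z) = z / 2" for z :: complex
      using a(2) by (simp flip: mult.assoc)
    show ?thesis
      using False unfolding householder_two(2)[OF False a(1)]
      by (auto simp: t_def Transposition.transpose_def algebra_simps 1)
  qed
  show ?thesis
    using \<nu> householder_two(1)[OF False a(1)] unfolding orth_inv_states_def
    by (subst (2) moment_transform[of \<nu> "cmat_of_real ?V"]) (auto simp: V moment_def)
qed

text \<open>Two transpositions carry \<open>(p, q)\<close> to \<open>(p', q')\<close>: the first
  moves \<open>p\<close> to \<open>p'\<close>, the second moves the image of \<open>q\<close> to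
  \<open>q'\<close>. The second fixes \<open>p'\<close>, since \<open>p'\<close> differs from
  \<open>q'\<close> and from the image of \<open>q\<close>.\<close>

lemma moment_two_point:
  fixes \<nu> :: "(complex^'n) measure"
  assumes \<nu>: "orth_inv_states \<nu>" and "p \<noteq> q" "p' \<noteq> q'"
  shows "moment \<nu> p p q q = moment \<nu> p' p' q' q'" "moment \<nu> p q p q = moment \<nu> p' q' p' q'"
proof -
  let ?t = "Transposition.transpose p p'"
  let ?u = "Transposition.transpose (?t q) q'"
  have 1: "?t p = p'" "?u p' = p'" "?u (?t q) = q'"
    using assms(2,3) by (auto simp: Transposition.transpose_def)
  note T = moment_transpose[OF \<nu>]
  show "moment \<nu> p p q q = moment \<nu> p' p' q' q'"
    using T[of p p' p p q q] T[of "?t q" q' p' p' "?t q" "?t q"] unfolding 1 by simp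
  show "moment \<nu> p q p q = moment \<nu> p' q' p' q'"
    using T[of p p' p q p q] T[of "?t q" q' p' "?t q" p' "?t q"] unfolding 1 by simp
qed

text \<open>Sign changes and swaps alone leave the diagonal moment independent of the two-point
  moments. Expanding the image of coordinate \<open>p\<close> under a mixing reflection to fourth
  order ties them together.\<close>

lemma moment_diag:
  fixes \<nu> :: "(complex^'n) measure"
  assumes \<nu>: "orth_inv_states \<nu>" and pq: "p \<noteq> q"
  shows "moment \<nu> p p p p = moment \<nu> p p q q + 2 * moment \<nu> p q p q"
proof -
  \<comment> \<open>Any reflection that genuinely mixes the coordinates \<open>p\<close> and \<open>q\<close> yields the relation;
    this one has the rational row \<open>(3/5, -4/5)\<close>.\<close>
  define a b where "a = 1 / sqrt (5::real)" and "b = 2 / sqrt (5::real)"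
  have ab: "a\<^sup>2 + b\<^sup>2 = 1" "complex_of_real a * complex_of_real a = 1 / 5" "complex_of_real a * complex_of_real b = 2 / 5"
    by (simp_all add: a_def b_def power_divide flip: of_real_mult)
  let ?V = "householder (\<chi> i. if i = p then a else if i = q then b else 0)"
  let ?m = "\<lambda>p q r s (x::complex^'n). x $ p * x $ q * cnj (x $ r) * cnj (x $ s)"
  define c d :: complex where "c = 3/5" and "d = -4/5"
  have cd: "cnj c = c" "cnj d = d" by (simp_all add: c_def d_def)
  have V: "(cmat_of_real ?V *v x) $ p = c * x $ p + d * x $ q" for x
  proof -
    have "(cmat_of_real ?V *v x) $ p = x $ p - 2 * (of_real a * of_real a * x $ p + of_real a * of_real b * x $ q)"
      unfolding householder_two(2)[OF pq ab(1)] by (simp add: algebra_simps)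
    then show ?thesis unfolding ab c_def d_def by (simp add: algebra_simps)
  qed
  \<comment> \<open>Booleans label the two coordinates, so the sum over quadruples of booleans is
    the expansion of the fourfold product into 16 terms. Those in which \<open>p\<close> occurs an
    odd number of times vanish, which leaves 8.\<close>
  let ?f = "\<lambda>i. if i then p else q" and ?g = "\<lambda>i. if i then c else d"
  have "moment \<nu> p p p p = (\<integral>x. (\<Sum>(i,j,k,l)\<in>UNIV. ?g i * ?g j * ?g k * ?g l * ?m (?f i) (?f j) (?f k) (?f l) x) \<partial>\<nu>)"
    using \<nu> householder_two(1)[OF pq ab(1)] unfolding orth_inv_states_def
    by (subst moment_transform[of \<nu> "cmat_of_real ?V"])
       (auto simp: V cd UNIV_Times_UNIV[symmetric] UNIV_bool sum.cartesian_product[symmetric] algebra_simps intro!: Bochner_Integration.integral_cong simp del: UNIV_Times_UNIV)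
  also have "\<dots> = (\<Sum>(i,j,k,l)\<in>UNIV. ?g i * ?g j * ?g k * ?g l * moment \<nu> (?f i) (?f j) (?f k) (?f l))"
    unfolding case_prod_beta moment_def
    by (subst Bochner_Integration.integral_sum) (auto intro!: integrable_mult_right moment_integrable \<nu>)
  also have "\<dots> = c^4 * moment \<nu> p p p p + d^4 * moment \<nu> q q q q +
      c^2 * d^2 * (moment \<nu> p p q q + moment \<nu> q q p p
      + moment \<nu> p q p q + moment \<nu> p q q p + moment \<nu> q p p q + moment \<nu> q p q p)"
    using pq by (simp add: UNIV_Times_UNIV[symmetric] UNIV_bool sum.cartesian_product[symmetric] moment_eq_0[OF \<nu>]
       power4_eq_xxxx power2_eq_square algebra_simps del: UNIV_Times_UNIV)
  also have "moment \<nu> q q q q = moment \<nu> p p p p"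
    using moment_transpose[OF \<nu>, of p q p p p p] by simp
  also have "moment \<nu> q q p p = moment \<nu> p p q q"
    using moment_two_point[OF \<nu>] pq by metis
  also have "moment \<nu> p q q p = moment \<nu> p q p q" by (rule moment_commute)
  also have "moment \<nu> q p p q = moment \<nu> p q p q" by (rule moment_commute)
  also have "moment \<nu> q p q p = moment \<nu> p q p q" by (metis moment_commute)
  \<comment> \<open>Since \<open>c^2 + d^2 = 1\<close>, both sides carry the factor
    \<open>1 - c^4 - d^4 = 2 * c^2 * d^2 = 288 / 625\<close>.\<close>
  finally have "288 * moment \<nu> p p p p = 288 * (moment \<nu> p p q q + 2 * moment \<nu> p q p q)"
    unfolding c_def d_def by (simp add: field_simps power4_eq_xxxx power2_eq_square)
  then show ?thesis by (simp only: mult_cancel_left) simp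
qed

section \<open>Contractions and the form of the moment tensor\<close>

lemma norm_eq_1_iff: "norm (x :: complex^'n) = 1 \<longleftrightarrow> (\<Sum>p\<in>UNIV. x $ p * cnj (x $ p)) = 1"
proof -
  have "(\<Sum>p\<in>UNIV. x $ p * cnj (x $ p)) = of_real (\<Sum>p\<in>UNIV. (norm (x $ p))\<^sup>2)"
    by (simp add: complex_norm_square[symmetric] flip: of_real_power)
  also have "\<dots> = 1 \<longleftrightarrow> norm x = 1"
    unfolding norm_vec_def L2_set_def real_sqrt_eq_1_iff of_real_eq_1_iff ..
  finally show ?thesis by simp
qed

text \<open>This contraction of the tensor is the mean of the fourth power of the norm.\<close>

lemma sum_moment_norm:
  fixes \<nu> :: "(complex^'n) measure"
  assumes \<nu>: "orth_inv_states \<nu>"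
  shows "(\<Sum>p\<in>UNIV. \<Sum>q\<in>UNIV. moment \<nu> p q p q) = 1"
proof -
  interpret prob_space \<nu> using \<nu> by (simp add: orth_inv_states_def)
  have "(\<Sum>p\<in>UNIV. \<Sum>q\<in>UNIV. moment \<nu> p q p q)
    = (\<integral>x. (\<Sum>p\<in>UNIV. \<Sum>q\<in>UNIV. x $ p * x $ q * cnj (x $ p) * cnj (x $ q)) \<partial>\<nu>)"
    unfolding moment_def
    by (subst Bochner_Integration.integral_sum, (intro Bochner_Integration.integrable_sum moment_integrable \<nu>))+ simp
  also have "\<dots> = (\<integral>x. (\<Sum>p\<in>UNIV. x $ p * cnj (x $ p)) * (\<Sum>q\<in>UNIV. x $ q * cnj (x $ q)) \<partial>\<nu>)"
    by (simp add: sum_product mult_ac)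
  also have "\<dots> = (\<integral>x. 1 \<partial>\<nu>)"
  proof (rule integral_cong_AE)
    show "AE x in \<nu>. (\<Sum>p\<in>UNIV. x $ p * cnj (x $ p)) * (\<Sum>q\<in>UNIV. x $ q * cnj (x $ q)) = 1"
      using \<nu> by (auto simp: orth_inv_states_def norm_eq_1_iff elim: eventually_mono)
    show "(\<lambda>x. (\<Sum>p\<in>UNIV. x $ p * cnj (x $ p)) * (\<Sum>q\<in>UNIV. x $ q * cnj (x $ q))) \<in> borel_measurable \<nu>"
      by (intro borel_measurable_integrable bdd_prob_integrable orth_inv_states_bdd \<nu> continuous_intros)
  qed simp
  finally show ?thesis by (simp add: prob_space)
qed

text \<open>The squared overlap of \<open>x\<close> with its complex conjugate. Real orthogonal
  matrices preserve it while general unitary ones do not, which is why the two group averages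
  differ.\<close>

definition sq_overlap :: "complex^'n \<Rightarrow> real" where
  "sq_overlap x = (cmod (\<Sum>p\<in>UNIV. x $ p * x $ p))\<^sup>2"

lemma continuous_sq_overlap [continuous_intros]:
  "continuous_on S f \<Longrightarrow> continuous_on S (\<lambda>t. sq_overlap (f t))"
  unfolding sq_overlap_def by (intro continuous_intros)

lemma sum_moment_sq_overlap:
  fixes \<nu> :: "(complex^'n) measure"
  assumes \<nu>: "orth_inv_states \<nu>"
  shows "(\<Sum>p\<in>UNIV. \<Sum>q\<in>UNIV. moment \<nu> p p q q) = of_real (\<integral>x. sq_overlap x \<partial>\<nu>)"
proof -
  have "(\<Sum>p\<in>UNIV. \<Sum>q\<in>UNIV. moment \<nu> p p q q)
    = (\<integral>x. (\<Sum>p\<in>UNIV. \<Sum>q\<in>UNIV. x $ p * x $ p * cnj (x $ q) * cnj (x $ q)) \<partial>\<nu>)"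
    unfolding moment_def
    by (subst Bochner_Integration.integral_sum, (intro Bochner_Integration.integrable_sum moment_integrable \<nu>))+ simp
  also have "\<dots> = (\<integral>x. of_real (sq_overlap x) \<partial>\<nu>)"
    unfolding sq_overlap_def complex_norm_square by (simp add: sum_product mult_ac)
  finally show ?thesis by simp
qed

lemma card_ne_1_obtain:
  assumes "CARD('n) \<noteq> 1"
  obtains u v :: "'n::finite" where "u \<noteq> v"
proof -
  have "is_singleton (UNIV :: 'n set)" if "\<forall>u v :: 'n. u = v"
    using that by (intro is_singletonI') auto
  then show ?thesis using that assms by (auto simp: is_singleton_altdef)
qed

text \<open>Only the three pairings of the indices survive, and \<open>moment_diag\<close> makes the
  value at four equal indices consistent with their sum. The last two clauses locate
  \<open>\<alpha>\<close> in every dimension, so that it can later be shown to vanish for uniform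
  states.\<close>

lemma moment_form_obtain:
  fixes \<nu> :: "(complex^'n) measure"
  assumes \<nu>: "orth_inv_states \<nu>"
  obtains \<alpha> \<beta> where
    "\<And>p q r s. moment \<nu> p q r s =
       \<alpha> * of_bool (p = q \<and> r = s) + \<beta> * (of_bool (p = r \<and> q = s) + of_bool (p = s \<and> q = r))"
    and "CARD('n) = 1 \<Longrightarrow> \<alpha> = 0" and "\<And>p q. p \<noteq> q \<Longrightarrow> moment \<nu> p p q q = \<alpha>"
proof (cases "CARD('n) = 1")
  case True
  then obtain a :: 'n where a: "UNIV = {a}" by (auto simp: card_1_singleton_iff)
  then have eq: "p = a" for p by blast
  have "moment \<nu> a a a a = 1" using sum_moment_norm[OF \<nu>] by (simp add: a)
  \<comment> \<open>In dimension one all three delta tensors equal 1 and only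
    \<open>\<alpha> + 2 * \<beta> = 1\<close> is determined. The choice \<open>\<alpha> = 0\<close>
    agrees with the unitary case.\<close>
  then have "moment \<nu> p q r s = 0 * of_bool (p = q \<and> r = s) + 1/2 * (of_bool (p = r \<and> q = s) + of_bool (p = s \<and> q = r))"
    for p q r s
    unfolding eq[of p] eq[of q] eq[of r] eq[of s] by simp
  then show ?thesis
  proof (rule that)
    show "moment \<nu> p p q q = 0" if "p \<noteq> q" for p q
      using that eq[of p] eq[of q] by simp
  qed simp
next
  case False
  obtain u v :: 'n where uv: "u \<noteq> v"
    using card_ne_1_obtain[OF False] .
  define \<alpha> \<beta> where "\<alpha> = moment \<nu> u u v v" and "\<beta> = moment \<nu> u v u v"
  have two: "moment \<nu> p p q q = \<alpha>" "moment \<nu> p q p q = \<beta>" "moment \<nu> p q q p = \<beta>" if "p \<noteq> q" for p q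
    using moment_two_point[OF \<nu> that uv] moment_commute(2)[of \<nu> p q q p] by (simp_all add: \<alpha>_def \<beta>_def)
  have one: "moment \<nu> p p p p = \<alpha> + 2 * \<beta>" for p
  proof -
    obtain q where "p \<noteq> q" using uv by metis
    then show ?thesis using moment_diag[OF \<nu> \<open>p \<noteq> q\<close>] two[OF \<open>p \<noteq> q\<close>] by simp
  qed
  show ?thesis
  proof (rule that)
    show "moment \<nu> p q r s =
       \<alpha> * of_bool (p = q \<and> r = s) + \<beta> * (of_bool (p = r \<and> q = s) + of_bool (p = s \<and> q = r))" for p q r s
    proof -
      consider "p = q" "r = s" "p = r" | "p = q" "r = s" "p \<noteq> r" | "p = r" "q = s" "p \<noteq> q"
        | "p = s" "q = r" "p \<noteq> q" | "\<not> (p = q \<and> r = s)" "\<not> (p = r \<and> q = s)" "\<not> (p = s \<and> q = r)"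
        by metis
      then show ?thesis
        
      proof cases
        case 5
        show ?thesis unfolding moment_eq_0[OF \<nu> 5] of_bool_def if_not_P[OF 5(1)] if_not_P[OF 5(2)] if_not_P[OF 5(3)]
          by (simp only: mult_zero_right add_0_right)
      qed (simp_all add: one two)
    qed
    show "CARD('n) = 1 \<Longrightarrow> \<alpha> = 0" using False by simp
  qed (rule two)
qed

text \<open>The two contractions of the tensor are evaluated once through its form and once as
  expectations. The resulting linear equations determine the coefficients unless
  \<open>N = 1\<close>, where both read \<open>\<alpha> + 2 * \<beta> = 1\<close>.\<close>

lemma moment_sum_rules:
  fixes \<nu> :: "(complex^'n) measure" and \<alpha> \<beta> :: complex
  assumes \<nu>: "orth_inv_states \<nu>"
    and m: "\<And>p q r s. moment \<nu> p q r s =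
       \<alpha> * of_bool (p = q \<and> r = s) + \<beta> * (of_bool (p = r \<and> q = s) + of_bool (p = s \<and> q = r))"
  defines "N \<equiv> of_nat CARD('n)"
  shows "\<alpha> * N + \<beta> * N * (N + 1) = 1" "\<alpha> * N\<^sup>2 + 2 * \<beta> * N = of_real (\<integral>x. sq_overlap x \<partial>\<nu>)"
proof -
  have d: "(\<Sum>p\<in>(UNIV::'n set). \<Sum>q\<in>UNIV. of_bool (p = q)) = N"
    by (simp add: N_def of_bool_def)
  have "(\<Sum>p\<in>UNIV. \<Sum>q\<in>UNIV. moment \<nu> p q p q)
    = (\<Sum>p\<in>(UNIV::'n set). \<Sum>q\<in>(UNIV::'n set). (\<alpha> + \<beta>) * of_bool (p = q) + \<beta>)"
    by (intro sum.cong) (auto simp: m algebra_simps)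
  also have "\<dots> = (\<alpha> + \<beta>) * N + \<beta> * N\<^sup>2"
    unfolding sum.distrib sum_distrib_left[symmetric] d by (simp add: N_def power2_eq_square mult_ac)
  finally show "\<alpha> * N + \<beta> * N * (N + 1) = 1"
    using sum_moment_norm[OF \<nu>] by (simp add: algebra_simps power2_eq_square)
  have "(\<Sum>p\<in>UNIV. \<Sum>q\<in>UNIV. moment \<nu> p p q q)
    = (\<Sum>p\<in>(UNIV::'n set). \<Sum>q\<in>(UNIV::'n set). \<alpha> + 2 * \<beta> * of_bool (p = q))"
    by (intro sum.cong) (auto simp: m algebra_simps)
  also have "\<dots> = \<alpha> * N\<^sup>2 + 2 * \<beta> * N"
    unfolding sum.distrib sum_distrib_left[symmetric] d by (simp add: N_def power2_eq_square mult_ac)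
  finally show "\<alpha> * N\<^sup>2 + 2 * \<beta> * N = of_real (\<integral>x. sq_overlap x \<partial>\<nu>)"
    using sum_moment_sq_overlap[OF \<nu>] by simp
qed

lemma unif_moment:
  fixes \<nu> :: "(complex^'n) measure"
  assumes \<nu>: "unif_pure_states \<nu>"
  shows "moment \<nu> p q r s = 1 / (of_nat CARD('n) * (of_nat CARD('n) + 1)) *
      (of_bool (p = r \<and> q = s) + of_bool (p = s \<and> q = r))"
proof -
  have o: "orth_inv_states \<nu>" using \<nu> by (rule unif_pure_states_orth_inv)
  have 0: "moment \<nu> u u v v = 0" if "u \<noteq> v" for u v
  proof -
    \<comment> \<open>The phase \<i> on coordinate \<open>u\<close> multiplies the square of that
      coordinate by -1 and leaves coordinate \<open>v\<close> unchanged, so the moment equals its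
      own negative.\<close>
    define V :: "complex^'n^'n" where "V = (\<chi> i j. if i = j then (if i = u then \<i> else 1) else 0)"
    have V: "(V *v x) $ i = (if i = u then \<i> else 1) * x $ i" for x i
      by (simp add: V_def matrix_vector_mult_def if_distrib[of "\<lambda>t. t * _"] cong: if_cong)
    have "unitary_mat V"
      by (auto simp: unitary_mat_def cmat_adj_def V_def matrix_matrix_mult_def vec_eq_iff mat_def
          if_distrib[of "\<lambda>t. t * _"] if_distrib[of "\<lambda>t. _ * t"] if_distrib[of cnj] cong: if_cong)
    then have "distr \<nu> borel (\<lambda>x. V *v x) = \<nu>" "sets \<nu> = sets borel"
      using \<nu> by (auto simp: unif_pure_states_def)
    then have "moment \<nu> u u v v = (\<integral>x. - (x $ u * x $ u * cnj (x $ v) * cnj (x $ v)) \<partial>\<nu>)"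
      using that by (subst moment_transform[of \<nu> V]) (auto simp: V mult_ac complex_i_mult_minus intro!: Bochner_Integration.integral_cong)
    also have "\<dots> = - moment \<nu> u u v v" by (simp add: moment_def)
    finally show ?thesis by simp
  qed
  obtain \<alpha> \<beta> where m: "\<And>p q r s. moment \<nu> p q r s =
       \<alpha> * of_bool (p = q \<and> r = s) + \<beta> * (of_bool (p = r \<and> q = s) + of_bool (p = s \<and> q = r))"
    and "CARD('n) = 1 \<Longrightarrow> \<alpha> = 0" and a: "\<And>p q. p \<noteq> q \<Longrightarrow> moment \<nu> p p q q = \<alpha>"
    using moment_form_obtain[OF o] by metis
  moreover have "\<alpha> = 0" if *: "CARD('n) \<noteq> 1"
  proof -
    obtain u v :: 'n where "u \<noteq> v"
      using card_ne_1_obtain[OF *] .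
    then show ?thesis using a 0 by metis
  qed
  ultimately have "\<alpha> = 0" by blast
  moreover have "of_nat CARD('n) * (of_nat CARD('n) + 1 :: complex) \<noteq> 0"
    by (simp flip: of_nat_Suc add.commute[of 1])
  ultimately have "\<beta> = 1 / (of_nat CARD('n) * (of_nat CARD('n) + 1))"
    using moment_sum_rules(1)[OF o m] by (simp add: field_simps)
  then show ?thesis using m \<open>\<alpha> = 0\<close> by simp
qed

text \<open>With \<open>\<alpha> = 0\<close> the second sum rule reads
  \<open>2 * \<beta> * N\<close>, and \<open>\<beta> = 1 / (N * (N + 1))\<close>. This mean produces
  the factors \<open>d + 1\<close> in the orthogonal formula.\<close>

lemma unif_sq_overlap:
  fixes \<nu> :: "(complex^'n) measure"
  assumes \<nu>: "unif_pure_states \<nu>"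
  shows "(\<integral>x. sq_overlap x \<partial>\<nu>) = 2 / (real CARD('n) + 1)"
proof -
  let ?b = "1 / (of_nat CARD('n) * (of_nat CARD('n) + 1)) :: complex"
  have "2 * ?b * of_nat CARD('n) = of_real (\<integral>x. sq_overlap x \<partial>\<nu>)"
    using moment_sum_rules(2)[OF unif_pure_states_orth_inv[OF \<nu>], of 0 ?b] unif_moment[OF \<nu>] by simp
  moreover have "2 * ?b * of_nat CARD('n) = of_real (2 / (real CARD('n) + 1))" by simp
  ultimately show ?thesis by (metis of_real_eq_iff)
qed

section \<open>Mean purities and mean one-tangle\<close>

text \<open>The injection \<open>g\<close> splits an index into a kept and a traced part, so one
  statement serves all three bipartitions. The \<open>\<alpha>\<close> pairing forces
  \<open>i = i'\<close> and \<open>j = j'\<close>, while the two \<open>\<beta>\<close> pairings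
  force only \<open>i = i'\<close> or only \<open>j = j'\<close>; counting gives
  \<open>X * Y\<close>, \<open>X * Y^2\<close> and \<open>X^2 * Y\<close>.\<close>

lemma purity_mean:
  fixes \<nu> :: "(complex^'n) measure" and g :: "'x::finite \<Rightarrow> 'y::finite \<Rightarrow> 'n" and \<alpha> \<beta> :: complex
  assumes \<nu>: "orth_inv_states \<nu>"
    and m: "\<And>p q r s. moment \<nu> p q r s =
       \<alpha> * of_bool (p = q \<and> r = s) + \<beta> * (of_bool (p = r \<and> q = s) + of_bool (p = s \<and> q = r))"
    and g: "\<And>i j i' j'. g i j = g i' j' \<longleftrightarrow> i = i' \<and> j = j'"
  defines "X \<equiv> real CARD('x)" and "Y \<equiv> real CARD('y)"
  shows "(\<integral>\<psi>. purity (\<lambda>i i'. \<Sum>j\<in>UNIV. \<psi> $ g i j * cnj (\<psi> $ g i' j)) \<partial>\<nu>)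
      = X * Y * (Re \<alpha> + Re \<beta> * (X + Y))"
proof -
  let ?m = "\<lambda>p q r s (x::complex^'n). x $ p * x $ q * cnj (x $ r) * cnj (x $ s)"
  have "purity (\<lambda>i i'. \<Sum>j\<in>UNIV. \<psi> $ g i j * cnj (\<psi> $ g i' j)) =
     (\<Sum>i\<in>UNIV. \<Sum>i'\<in>UNIV. \<Sum>j\<in>UNIV. \<Sum>j'\<in>UNIV. Re (?m (g i j) (g i' j') (g i' j) (g i j') \<psi>))" for \<psi>
    unfolding purity_def sum_product Re_sum by (simp only: mult_ac)
  then have "(\<integral>\<psi>. purity (\<lambda>i i'. \<Sum>j\<in>UNIV. \<psi> $ g i j * cnj (\<psi> $ g i' j)) \<partial>\<nu>)
    = (\<integral>\<psi>. (\<Sum>i\<in>UNIV. \<Sum>i'\<in>UNIV. \<Sum>j\<in>UNIV. \<Sum>j'\<in>UNIV. Re (?m (g i j) (g i' j') (g i' j) (g i j') \<psi>)) \<partial>\<nu>)"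
    by (simp only:)
  also have "\<dots> = (\<Sum>i\<in>UNIV. \<Sum>i'\<in>UNIV. \<Sum>j\<in>UNIV. \<Sum>j'\<in>UNIV. Re (moment \<nu> (g i j) (g i' j') (g i' j) (g i j')))"
    unfolding moment_def integral_Re[OF moment_integrable[OF \<nu>], symmetric]
    by (subst Bochner_Integration.integral_sum, (intro Bochner_Integration.integrable_sum integrable_Re moment_integrable \<nu>))+ simp
  also have "\<dots> = (\<Sum>i\<in>(UNIV::'x set). \<Sum>i'\<in>(UNIV::'x set). \<Sum>j\<in>(UNIV::'y set). \<Sum>j'\<in>(UNIV::'y set).
      Re \<alpha> * (of_bool (i = i') * of_bool (j = j')) + Re \<beta> * of_bool (i = i') + Re \<beta> * of_bool (j = j'))"
    by (intro sum.cong) (auto simp: m g)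
  also have "\<dots> = X * Y * (Re \<alpha> + Re \<beta> * (X + Y))"
    by (simp add: sum.distrib sum_distrib_left[symmetric] X_def Y_def of_bool_def algebra_simps)
  finally show ?thesis .
qed

lemma continuous_purity [continuous_intros]:
  assumes "\<And>i j. continuous_on S (\<lambda>t. f t i j)"
  shows "continuous_on S (\<lambda>t. purity (f t))"
  unfolding purity_def by (intro continuous_intros assms)

lemma continuous_one_tangle [continuous_intros]:
  "continuous_on S f \<Longrightarrow> continuous_on S (\<lambda>t. one_tangle (f t))"
  unfolding one_tangle_def tau_12_3_def tau_13_2_def tau_23_1_def rho1_def rho2_def rho3_def
  by (intro continuous_intros) auto

lemma one_tangle_mean:
  fixes \<nu> :: "(complex^('a::finite \<times> 'b::finite \<times> 'c::finite)) measure" and \<alpha> \<beta> :: complex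
  assumes \<nu>: "orth_inv_states \<nu>"
    and m: "\<And>p q r s. moment \<nu> p q r s =
       \<alpha> * of_bool (p = q \<and> r = s) + \<beta> * (of_bool (p = r \<and> q = s) + of_bool (p = s \<and> q = r))"
  defines "d1 \<equiv> real CARD('a)" and "d2 \<equiv> real CARD('b)" and "d3 \<equiv> real CARD('c)"
  shows "(\<integral>\<psi>. one_tangle \<psi> \<partial>\<nu>) = 2 / 3 * (3 - 3 * (d1*d2*d3) * Re \<alpha>
      - d1*d2*d3 * Re \<beta> * (d1 + d2 + d3 + d1*d2 + d1*d3 + d2*d3))"
proof -
  interpret prob_space \<nu> using \<nu> by (simp add: orth_inv_states_def)
  \<comment> \<open>The two traced indices are merged into one pair-valued index, the shape that
    \<open>purity_mean\<close> expects.\<close>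
  have r1: "rho1 \<psi> = (\<lambda>i i'. \<Sum>j\<in>UNIV. \<psi> $ (i, fst j, snd j) * cnj (\<psi> $ (i', fst j, snd j)))" for \<psi> :: "complex^('a \<times> 'b \<times> 'c)"
    by (simp add: fun_eq_iff rho1_def sum.cartesian_product case_prod_beta)
  have r2: "rho2 \<psi> = (\<lambda>i i'. \<Sum>j\<in>UNIV. \<psi> $ (fst j, i, snd j) * cnj (\<psi> $ (fst j, i', snd j)))" for \<psi> :: "complex^('a \<times> 'b \<times> 'c)"
    by (simp add: fun_eq_iff rho2_def sum.cartesian_product case_prod_beta)
  have r3: "rho3 \<psi> = (\<lambda>i i'. \<Sum>j\<in>UNIV. \<psi> $ (fst j, snd j, i) * cnj (\<psi> $ (fst j, snd j, i')))" for \<psi> :: "complex^('a \<times> 'b \<times> 'c)"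
    by (simp add: fun_eq_iff rho3_def sum.cartesian_product case_prod_beta)
  have p1: "(\<integral>\<psi>. purity (rho1 \<psi>) \<partial>\<nu>) = d1*d2*d3 * (Re \<alpha> + Re \<beta> * (d1 + d2*d3))"
    unfolding r1 by (subst purity_mean[OF \<nu> m]) (auto simp: d1_def d2_def d3_def prod_eq_iff)
  have p2: "(\<integral>\<psi>. purity (rho2 \<psi>) \<partial>\<nu>) = d1*d2*d3 * (Re \<alpha> + Re \<beta> * (d2 + d1*d3))"
    unfolding r2 by (subst purity_mean[OF \<nu> m]) (auto simp: d1_def d2_def d3_def prod_eq_iff)
  have p3: "(\<integral>\<psi>. purity (rho3 \<psi>) \<partial>\<nu>) = d1*d2*d3 * (Re \<alpha> + Re \<beta> * (d3 + d1*d2))"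
    unfolding r3 by (subst purity_mean[OF \<nu> m]) (auto simp: d1_def d2_def d3_def prod_eq_iff)
  have i: "integrable \<nu> (\<lambda>\<psi>. purity (rho1 \<psi>))" "integrable \<nu> (\<lambda>\<psi>. purity (rho2 \<psi>))" "integrable \<nu> (\<lambda>\<psi>. purity (rho3 \<psi>))"
    unfolding rho1_def rho2_def rho3_def
    by (intro bdd_prob_integrable orth_inv_states_bdd \<nu> continuous_intros)+
  have "(\<integral>\<psi>. one_tangle \<psi> \<partial>\<nu>)
     = (\<integral>\<psi>. 2 - 2 / 3 * (purity (rho1 \<psi>) + purity (rho2 \<psi>) + purity (rho3 \<psi>)) \<partial>\<nu>)"
    by (simp add: one_tangle_def tau_12_3_def tau_13_2_def tau_23_1_def field_simps)
  also have "\<dots> = 2 - 2 / 3 * ((\<integral>\<psi>. purity (rho1 \<psi>) \<partial>\<nu>) + (\<integral>\<psi>. purity (rho2 \<psi>) \<partial>\<nu>) + (\<integral>\<psi>. purity (rho3 \<psi>) \<partial>\<nu>))"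
    using i by (simp add: prob_space)
  finally show ?thesis unfolding p1 p2 p3 by (simp add: field_simps)
qed

text \<open>Here \<open>A\<close> is \<open>3 * (N + 1)\<close> minus the dimensions of both sides
  of each of the three cuts, with \<open>N = d1*d2*d3\<close>. The formula follows from
  \<open>\<alpha> = 0\<close> and \<open>N * \<beta> = 1 / (N + 1)\<close>.\<close>

lemma unif_one_tangle_mean:
  fixes \<nu> :: "(complex^('a::finite \<times> 'b::finite \<times> 'c::finite)) measure"
  assumes \<nu>: "unif_pure_states \<nu>"
  defines "d1 \<equiv> real CARD('a)" and "d2 \<equiv> real CARD('b)" and "d3 \<equiv> real CARD('c)"
  defines "A \<equiv> 3 - d1 - d2 - d3 - d1*d2 - d1*d3 - d2*d3 + 3*d1*d2*d3"
  shows "(\<integral>\<psi>. one_tangle \<psi> \<partial>\<nu>) = 2 * A / (3 * (d1*d2*d3 + 1))"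
proof -
  define N where "N = d1*d2*d3"
  have N: "N > 0" by (simp add: N_def d1_def d2_def d3_def)
  define \<beta> :: complex where "\<beta> = 1 / (of_nat CARD('a \<times> 'b \<times> 'c) * (of_nat CARD('a \<times> 'b \<times> 'c) + 1))"
  have "\<beta> = of_real (1 / (N * (N + 1)))"
    by (simp add: \<beta>_def N_def d1_def d2_def d3_def mult.assoc)
  then have b: "Re \<beta> = 1 / (N * (N + 1))" by simp
  have "(\<integral>\<psi>. one_tangle \<psi> \<partial>\<nu>) = 2 / 3 * (3 - N * Re \<beta> * (d1 + d2 + d3 + d1*d2 + d1*d3 + d2*d3))"
    using one_tangle_mean[OF unif_pure_states_orth_inv[OF \<nu>], of 0 \<beta>] unif_moment[OF \<nu>]
    by (simp add: N_def d1_def d2_def d3_def \<beta>_def)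
  also have "N * Re \<beta> = 1 / (N + 1)" using N by (simp add: b)
  finally show ?thesis using N
    unfolding A_def N_def[symmetric] mult.assoc[of 3] by (simp add: divide_simps N_def) (simp add: algebra_simps)
qed

text \<open>If \<open>d1*d2*d3 = 1\<close>, the right-hand side is a division by zero; both sides are then \<open>0\<close>.\<close>
lemma orth_inv_one_tangle_mean:
  fixes \<nu> :: "(complex^('a::finite \<times> 'b::finite \<times> 'c::finite)) measure"
  assumes \<nu>: "orth_inv_states \<nu>"
  defines "d1 \<equiv> real CARD('a)" and "d2 \<equiv> real CARD('b)" and "d3 \<equiv> real CARD('c)"
  defines "A \<equiv> 3 - d1 - d2 - d3 - d1*d2 - d1*d3 - d2*d3 + 3*d1*d2*d3"
  shows "(\<integral>\<psi>. one_tangle \<psi> \<partial>\<nu>) =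
     2 * A * (d1*d2*d3 - (\<integral>x. sq_overlap x \<partial>\<nu>)) / (3 * (d1*d2*d3 - 1) * (d1*d2*d3 + 2))"
proof -
  define N s where "N = d1*d2*d3" and "s = (\<integral>x. sq_overlap x \<partial>\<nu>)"
  have pos: "d1 > 0" "d2 > 0" "d3 > 0" by (simp_all add: d1_def d2_def d3_def)
  then have N: "N > 0" by (simp add: N_def)
  obtain \<alpha> \<beta> where m: "\<And>p q r s. moment \<nu> p q r s =
       \<alpha> * of_bool (p = q \<and> r = s) + \<beta> * (of_bool (p = r \<and> q = s) + of_bool (p = s \<and> q = r))"
    using moment_form_obtain[OF \<nu>] by metis
  define a b where "a = N * Re \<alpha>" and "b = N * Re \<beta>"
  have c: "(of_nat CARD('a \<times> 'b \<times> 'c) :: complex) = of_real N"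
    by (simp add: N_def d1_def d2_def d3_def)
  have e1: "a + b * (N + 1) = 1"
    using arg_cong[OF moment_sum_rules(1)[OF \<nu> m], of Re] unfolding c a_def b_def by (simp add: algebra_simps)
  have e2: "a * N + 2 * b = s"
    using arg_cong[OF moment_sum_rules(2)[OF \<nu> m], of Re] unfolding c a_def b_def s_def
    by (simp add: algebra_simps power2_eq_square)
  have L: "(\<integral>\<psi>. one_tangle \<psi> \<partial>\<nu>) = 2 / 3 * (3 - 3 * a - b * (3 * N + 3 - A))"
    using one_tangle_mean[OF \<nu> m] by (simp add: N_def d1_def d2_def d3_def a_def b_def A_def algebra_simps)
  show ?thesis
  proof (cases "N = 1")
    case True
    have "CARD('a) * CARD('b) * CARD('c) = 1"
      using True unfolding N_def d1_def d2_def d3_def by (simp only: of_nat_mult[symmetric] of_nat_eq_1_iff)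
    then have "d1 = 1" "d2 = 1" "d3 = 1" unfolding d1_def d2_def d3_def by simp_all
    then have "A = 0" by (simp add: A_def)
    then show ?thesis using L e1 True by (simp add: N_def)
  next
    case False
    have a: "a = 1 - b * (N + 1)" using e1 by simp
    \<comment> \<open>Eliminating \<open>a\<close> from the second sum rule leaves the coefficient
      \<open>N * (N + 1) - 2\<close> of \<open>b\<close>, which factors as
      \<open>(N - 1) * (N + 2)\<close>; this is the origin of the denominator.\<close>
    have "b * ((N - 1) * (N + 2)) = N - s"
      using e2 unfolding a by (simp add: algebra_simps)
    moreover have "(N - 1) * (N + 2) \<noteq> 0" using False N by simp
    ultimately have b: "b = (N - s) / ((N - 1) * (N + 2))" by (metis nonzero_eq_divide_eq)
    have "(\<integral>\<psi>. one_tangle \<psi> \<partial>\<nu>) = 2 / 3 * (b * A)"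
      unfolding L a by (simp add: algebra_simps)
    then show ?thesis unfolding b by (simp add: N_def s_def mult_ac)
  qed
qed

section \<open>Preserved bilinear forms and product states\<close>

text \<open>Taking \<open>B\<close> as the entrywise conjugate of a unitary \<open>A\<close> gives
  preservation of the norm; taking \<open>A = B\<close> real orthogonal gives preservation of the
  form without conjugation that underlies \<open>sq_overlap\<close>.\<close>

lemma sum_mat_vec_product:
  fixes A B :: "complex^'n^'n" and x y :: "complex^'n"
  assumes "\<And>j k. (\<Sum>i\<in>UNIV. A $ i $ j * B $ i $ k) = of_bool (j = k)"
  shows "(\<Sum>i\<in>UNIV. (A *v x) $ i * (B *v y) $ i) = (\<Sum>j\<in>UNIV. x $ j * y $ j)"
proof -
  have "(\<Sum>i\<in>UNIV. (A *v x) $ i * (B *v y) $ i)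
     = (\<Sum>i\<in>UNIV. \<Sum>j\<in>UNIV. \<Sum>k\<in>UNIV. x $ j * y $ k * (A $ i $ j * B $ i $ k))"
    by (simp add: matrix_vector_mult_def sum_product mult_ac)
  also have "\<dots> = (\<Sum>j\<in>UNIV. \<Sum>i\<in>UNIV. \<Sum>k\<in>UNIV. x $ j * y $ k * (A $ i $ j * B $ i $ k))"
    by (rule sum.swap)
  also have "\<dots> = (\<Sum>j\<in>UNIV. \<Sum>k\<in>UNIV. \<Sum>i\<in>UNIV. x $ j * y $ k * (A $ i $ j * B $ i $ k))"
    by (intro sum.cong refl sum.swap)
  also have "\<dots> = (\<Sum>j\<in>UNIV. x $ j * y $ j)"
    by (simp add: sum_distrib_left[symmetric] assms of_bool_def if_distrib[of "\<lambda>t. _ * t"] cong: if_cong)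
  finally show ?thesis .
qed

lemma unitary_mat_columns:
  assumes "unitary_mat U"
  shows "(\<Sum>i\<in>UNIV. cnj (U $ i $ j) * U $ i $ k) = of_bool (j = k)"
  using assms by (simp add: unitary_mat_def cmat_adj_def matrix_matrix_mult_def vec_eq_iff mat_def of_bool_def)

lemma norm_unitary_mult:
  fixes x :: "complex^'n"
  assumes "unitary_mat U" "norm x = 1"
  shows "norm (U *v x) = 1"
proof -
  let ?c = "\<lambda>v :: complex^'n. (\<chi> i. cnj (v $ i))"
  \<comment> \<open>Conjugating the vector \<open>U *v x\<close> entrywise amounts to conjugating
    both factors, so the norm becomes a bilinear expression.\<close>
  have c: "(\<chi> i j. cnj (U $ i $ j)) *v ?c x = ?c (U *v x)"
    by (simp add: vec_eq_iff matrix_vector_mult_def)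
  have "(\<Sum>i\<in>UNIV. U $ i $ j * (\<chi> i j. cnj (U $ i $ j)) $ i $ k) = of_bool (j = k)" for j k
    using unitary_mat_columns[OF assms(1), of k j] by (simp add: mult.commute eq_commute)
  from sum_mat_vec_product[OF this, of x "?c x"]
  have "(\<Sum>i\<in>UNIV. (U *v x) $ i * cnj ((U *v x) $ i)) = (\<Sum>j\<in>UNIV. x $ j * cnj (x $ j))"
    unfolding c by simp
  then show ?thesis using assms(2) by (simp add: norm_eq_1_iff)
qed

lemma sq_overlap_orthogonal:
  assumes "orthogonal_matrix Q"
  shows "sq_overlap (cmat_of_real Q *v x) = sq_overlap x"
proof -
  have "(\<Sum>i\<in>UNIV. cmat_of_real Q $ i $ j * cmat_of_real Q $ i $ k) = of_bool (j = k)" for j k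
    using unitary_mat_columns[OF unitary_cmat_of_real[OF assms], of j k] by (simp add: cmat_of_real_def)
  then show ?thesis unfolding sq_overlap_def by (subst sum_mat_vec_product) auto
qed

lemma sum_prod_state:
  fixes f :: "'a::finite \<Rightarrow> complex" and g :: "'b::finite \<Rightarrow> complex" and h :: "'c::finite \<Rightarrow> complex"
  shows "(\<Sum>p\<in>UNIV. f (fst p) * g (fst (snd p)) * h (snd (snd p))) = sum f UNIV * sum g UNIV * sum h UNIV"
proof -
  have "(\<Sum>p\<in>UNIV. f (fst p) * g (fst (snd p)) * h (snd (snd p)))
      = (\<Sum>i\<in>UNIV. \<Sum>j\<in>UNIV. \<Sum>k\<in>UNIV. f i * g j * h k)"
    by (simp add: sum.cartesian_product case_prod_beta)
  also have "\<dots> = sum f UNIV * sum g UNIV * sum h UNIV"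
    by (simp add: sum_distrib_left[symmetric] sum_distrib_right[symmetric] mult.assoc)
  finally show ?thesis .
qed

lemma norm_prod_state:
  assumes "norm x = 1" "norm y = 1" "norm z = 1"
  shows "norm (prod_state x y z) = 1"
proof -
  have "(\<Sum>p\<in>UNIV. prod_state x y z $ p * cnj (prod_state x y z $ p))
    = (\<Sum>p\<in>UNIV. (x $ fst p * cnj (x $ fst p)) * (y $ fst (snd p) * cnj (y $ fst (snd p)))
        * (z $ snd (snd p) * cnj (z $ snd (snd p))))"
    by (simp add: prod_state_def mult_ac)
  also have "\<dots> = 1" using assms by (subst sum_prod_state) (simp add: norm_eq_1_iff)
  finally show ?thesis by (simp add: norm_eq_1_iff)
qed

lemma sq_overlap_prod_state:
  "sq_overlap (prod_state x y z) = sq_overlap x * sq_overlap y * sq_overlap z"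
proof -
  have "(\<Sum>p\<in>UNIV. prod_state x y z $ p * prod_state x y z $ p)
    = (\<Sum>p\<in>UNIV. (x $ fst p * x $ fst p) * (y $ fst (snd p) * y $ fst (snd p))
        * (z $ snd (snd p) * z $ snd (snd p)))"
    by (simp add: prod_state_def mult_ac)
  also have "\<dots> = (\<Sum>i\<in>UNIV. x $ i * x $ i) * (\<Sum>j\<in>UNIV. y $ j * y $ j) * (\<Sum>k\<in>UNIV. z $ k * z $ k)"
    by (rule sum_prod_state)
  finally show ?thesis by (simp add: sq_overlap_def norm_mult power_mult_distrib)
qed

lemma continuous_prod_state [continuous_intros]:
  assumes "continuous_on S f" "continuous_on S g" "continuous_on S h"
  shows "continuous_on S (\<lambda>t. prod_state (f t) (g t) (h t))"
  unfolding prod_state_def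
  by (intro continuous_on_vec_lambda continuous_intros assms)

section \<open>Orbits of a unit vector under Haar measure\<close>

text \<open>The norm on matrices is the Frobenius norm, and every column of a unitary matrix is a
  unit vector. This is what makes the Haar measures almost surely bounded.\<close>

lemma norm_unitary_le:
  fixes U :: "complex^'n^'n"
  assumes "unitary_mat U"
  shows "norm U \<le> sqrt (real CARD('n))"
proof -
  have "complex_of_real (\<Sum>i\<in>UNIV. \<Sum>j\<in>UNIV. (cmod (U $ i $ j))\<^sup>2) = (\<Sum>i\<in>UNIV. \<Sum>j\<in>UNIV. cnj (U $ i $ j) * U $ i $ j)"
    by (simp add: complex_norm_square[symmetric] mult.commute[of "cnj _"] flip: of_real_power)
  also have "\<dots> = (\<Sum>j\<in>UNIV. \<Sum>i\<in>UNIV. cnj (U $ i $ j) * U $ i $ j)"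
    by (rule sum.swap)
  also have "\<dots> = of_real (real CARD('n))"
    by (simp add: unitary_mat_columns[OF assms])
  finally have "(\<Sum>i\<in>UNIV. \<Sum>j\<in>UNIV. (cmod (U $ i $ j))\<^sup>2) = real CARD('n)"
    unfolding of_real_eq_iff .
  then show ?thesis by (simp add: norm_vec_def L2_set_def sum_nonneg)
qed

lemma haar_unitary_bdd: "haar_unitary \<mu> \<Longrightarrow> bdd_prob \<mu>"
  unfolding haar_unitary_def bdd_prob_def by (auto elim!: eventually_mono dest: norm_unitary_le)

lemma haar_orthogonal_bdd:
  fixes \<mu> :: "(real^'n^'n) measure"
  assumes "haar_orthogonal \<mu>"
  shows "bdd_prob \<mu>"
proof -
  have "norm Q = norm (cmat_of_real Q)" for Q :: "real^'n^'n"
    by (simp add: norm_vec_def cmat_of_real_def)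
  then have "norm Q \<le> sqrt (real CARD('n))" if "orthogonal_matrix Q" for Q :: "real^'n^'n"
    using norm_unitary_le[OF unitary_cmat_of_real[OF that]] by simp
  then show ?thesis
    using assms unfolding haar_orthogonal_def bdd_prob_def
    by (auto intro!: exI[of _ "sqrt (real CARD('n))"] elim!: eventually_mono)
qed

lemma borel_distr_comp:
  fixes f :: "'a::euclidean_space \<Rightarrow> 'b::euclidean_space" and g :: "'b \<Rightarrow> 'c::euclidean_space"
  assumes "sets M = sets borel" "continuous_on UNIV f" "continuous_on UNIV g"
  shows "distr (distr M borel f) borel g = distr M borel (\<lambda>x. g (f x))"
  using assms
  by (subst distr_distr)
     (auto intro!: borel_measurable_continuous_onI simp: measurable_cong_sets[OF assms(1) refl] comp_def)

lemma continuous_matrix_mult_left: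
  fixes V :: "'k::real_normed_algebra_1^'n^'m"
  shows "continuous_on UNIV (\<lambda>U :: 'k^'l^'n. V ** U)"
  unfolding matrix_matrix_mult_def
  by (intro continuous_on_vec_lambda continuous_intros)

lemma cmat_of_real_mult: "cmat_of_real (V ** Q) = cmat_of_real V ** cmat_of_real Q"
  by (simp add: cmat_of_real_def matrix_matrix_mult_def vec_eq_iff)

text \<open>Applying \<open>V\<close> to \<open>U *v \<psi>\<close> is the same as replacing
  \<open>U\<close> by \<open>V ** U\<close>, so left invariance of the Haar measure passes to the
  orbit.\<close>

lemma haar_unitary_orbit:
  fixes \<mu> :: "(complex^'n^'n) measure"
  assumes \<mu>: "haar_unitary \<mu>" and \<psi>: "norm \<psi> = 1"
  shows "unif_pure_states (distr \<mu> borel (\<lambda>U. U *v \<psi>))"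
proof -
  interpret prob_space \<mu> using \<mu> by (simp add: haar_unitary_def)
  have s: "sets \<mu> = sets borel" using \<mu> by (simp add: haar_unitary_def)
  have c: "continuous_on UNIV (\<lambda>U :: complex^'n^'n. U *v \<psi>)" by (intro continuous_intros)
  have meas: "(\<lambda>U. U *v \<psi>) \<in> borel_measurable \<mu>"
    using borel_measurable_continuous_onI[OF c] by (simp add: measurable_cong_sets[OF s refl])
  have "AE x in distr \<mu> borel (\<lambda>U. U *v \<psi>). norm x = 1"
    using \<mu> by (subst AE_distr_iff[OF meas]) (auto simp: haar_unitary_def norm_unitary_mult \<psi> elim!: eventually_mono)
  moreover have "distr (distr \<mu> borel (\<lambda>U. U *v \<psi>)) borel (\<lambda>x. V *v x) = distr \<mu> borel (\<lambda>U. U *v \<psi>)"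
    if "unitary_mat V" for V
  proof -
    have "distr (distr \<mu> borel (\<lambda>U. U *v \<psi>)) borel (\<lambda>x. V *v x)
        = distr (distr \<mu> borel (\<lambda>U. V ** U)) borel (\<lambda>U. U *v \<psi>)"
      by (simp add: borel_distr_comp s continuous_intros continuous_matrix_mult_left matrix_vector_mul_assoc)
    then show ?thesis using \<mu> that by (simp add: haar_unitary_def)
  qed
  ultimately show ?thesis using prob_space_distr[OF meas] by (simp add: unif_pure_states_def)
qed

text \<open>Left invariance passes to the orbit as in the unitary case. In addition
  \<open>sq_overlap\<close> is constant along the orbit, so its mean still remembers the starting
  vector.\<close>

lemma haar_orthogonal_orbit:
  fixes \<mu> :: "(real^'n^'n) measure"
  assumes \<mu>: "haar_orthogonal \<mu>" and \<psi>: "norm \<psi> = 1"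
  defines "\<nu> \<equiv> distr \<mu> borel (\<lambda>Q. cmat_of_real Q *v \<psi>)"
  shows "orth_inv_states \<nu>" "(\<integral>x. sq_overlap x \<partial>\<nu>) = sq_overlap \<psi>"
proof -
  interpret prob_space \<mu> using \<mu> by (simp add: haar_orthogonal_def)
  have s: "sets \<mu> = sets borel" using \<mu> by (simp add: haar_orthogonal_def)
  have c: "continuous_on UNIV (\<lambda>Q :: real^'n^'n. cmat_of_real Q *v \<psi>)" by (intro continuous_intros)
  have meas: "(\<lambda>Q. cmat_of_real Q *v \<psi>) \<in> borel_measurable \<mu>"
    using borel_measurable_continuous_onI[OF c] by (simp add: measurable_cong_sets[OF s refl])
  have "AE x in \<nu>. norm x = 1"
    unfolding \<nu>_def using \<mu>
    by (subst AE_distr_iff[OF meas])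
       (auto simp: haar_orthogonal_def norm_unitary_mult unitary_cmat_of_real \<psi> elim!: eventually_mono)
  moreover have "distr \<nu> borel (\<lambda>x. cmat_of_real V *v x) = \<nu>"
    if "orthogonal_matrix V" for V
  proof -
    have "distr \<nu> borel (\<lambda>x. cmat_of_real V *v x)
        = distr (distr \<mu> borel (\<lambda>Q. V ** Q)) borel (\<lambda>Q. cmat_of_real Q *v \<psi>)"
      unfolding \<nu>_def
      by (simp add: borel_distr_comp s continuous_intros continuous_matrix_mult_left cmat_of_real_mult matrix_vector_mul_assoc)
    then show ?thesis using \<mu> that by (simp add: haar_orthogonal_def \<nu>_def)
  qed
  moreover have "prob_space \<nu>" "sets \<nu> = sets borel"
    using prob_space_distr[OF meas] by (simp_all add: \<nu>_def)
  ultimately show "orth_inv_states \<nu>"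
    by (simp add: orth_inv_states_def)
  have "(\<integral>x. sq_overlap x \<partial>\<nu>) = (\<integral>Q. sq_overlap (cmat_of_real Q *v \<psi>) \<partial>\<mu>)"
    unfolding \<nu>_def by (intro borel_distr_integral s c continuous_intros)
  also have "\<dots> = (\<integral>Q. sq_overlap \<psi> \<partial>\<mu>)"
  proof (rule integral_cong_AE)
    show "(\<lambda>Q. sq_overlap (cmat_of_real Q *v \<psi>)) \<in> borel_measurable \<mu>"
      by (intro borel_measurable_integrable bdd_prob_integrable haar_orthogonal_bdd \<mu> continuous_intros)
    show "AE Q in \<mu>. sq_overlap (cmat_of_real Q *v \<psi>) = sq_overlap \<psi>"
      using \<mu> by (auto simp: haar_orthogonal_def sq_overlap_orthogonal elim!: eventually_mono)
  qed simp
  finally show "(\<integral>x. sq_overlap x \<partial>\<nu>) = sq_overlap \<psi>" by (simp add: prob_space)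
qed

section \<open>Exchanging the group average with the state averages\<close>

text \<open>Closedness of the two conditions makes their conjunction a closed, hence measurable, set
  of pairs; this measurability is what lifts almost sure statements to the product.\<close>

lemma AE_pair_closed:
  fixes M1 :: "'a::euclidean_space measure" and M2 :: "'b::euclidean_space measure"
  assumes M: "bdd_prob M1" "bdd_prob M2"
    and AE: "AE x in M1. P x" "AE y in M2. Q y" and cl: "closed {x. P x}" "closed {y. Q y}"
  shows "AE p in M1 \<Otimes>\<^sub>M M2. P (fst p) \<and> Q (snd p)"
proof -
  interpret M1: prob_space M1 using M by (simp add: bdd_prob_def)
  interpret M2: prob_space M2 using M by (simp add: bdd_prob_def)
  interpret pair_prob_space M1 M2 ..
  have sets: "sets (M1 \<Otimes>\<^sub>M M2) = sets borel" using bdd_prob_pair[OF M] by (simp add: bdd_prob_def)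
  have sp: "space (M1 \<Otimes>\<^sub>M M2) = UNIV" using sets_eq_imp_space_eq[OF sets] by simp
  have "{p. P (fst p) \<and> Q (snd p)} = {x. P x} \<times> {y. Q y}" by auto
  then have "closed {p. P (fst p) \<and> Q (snd p)}" using closed_Times[OF cl] by simp
  then have "{p \<in> space (M1 \<Otimes>\<^sub>M M2). P (fst p) \<and> Q (snd p)} \<in> sets (M1 \<Otimes>\<^sub>M M2)"
    unfolding sets sp by simp
  then show ?thesis
    by (rule AE_pair_measure) (use AE in simp)
qed

text \<open>The three state integrals are flattened into one over a product measure, and Fubini
  moves the group integral inside. The group average can then be evaluated for each fixed product
  state.\<close>

lemma average_swap:
  fixes F :: "'u::euclidean_space \<Rightarrow> complex^'a \<Rightarrow> complex^'b \<Rightarrow> complex^'c \<Rightarrow> real"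
    and \<nu>1 :: "(complex^'a) measure" and \<nu>2 :: "(complex^'b) measure" and \<nu>3 :: "(complex^'c) measure"
  assumes \<nu>: "orth_inv_states \<nu>1" "orth_inv_states \<nu>2" "orth_inv_states \<nu>3" and \<mu>: "bdd_prob \<mu>"
    and F: "continuous_on UNIV (\<lambda>(u, x, y, z). F u x y z)"
    and G: "continuous_on UNIV (\<lambda>(x, y, z). G x y z)"
    and eq: "\<And>x y z. norm x = 1 \<Longrightarrow> norm y = 1 \<Longrightarrow> norm z = 1 \<Longrightarrow> (\<integral>u. F u x y z \<partial>\<mu>) = G x y z"
  shows "(\<integral>u. (\<integral>x. (\<integral>y. (\<integral>z. F u x y z \<partial>\<nu>3) \<partial>\<nu>2) \<partial>\<nu>1) \<partial>\<mu>) = (\<integral>x. (\<integral>y. (\<integral>z. G x y z \<partial>\<nu>3) \<partial>\<nu>2) \<partial>\<nu>1)"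
proof -
  define M where "M = \<nu>1 \<Otimes>\<^sub>M (\<nu>2 \<Otimes>\<^sub>M \<nu>3)"
  note b = \<nu>[THEN orth_inv_states_bdd]
  have b23: "bdd_prob (\<nu>2 \<Otimes>\<^sub>M \<nu>3)" by (intro bdd_prob_pair b)
  have bM: "bdd_prob M" unfolding M_def by (intro bdd_prob_pair b)
  have nested: "(\<integral>p. H (fst p) (fst (snd p)) (snd (snd p)) \<partial>M) = (\<integral>x. (\<integral>y. (\<integral>z. H x y z \<partial>\<nu>3) \<partial>\<nu>2) \<partial>\<nu>1)"
    if H: "continuous_on UNIV (\<lambda>(x, y, z). H x y z)" for H :: "complex^'a \<Rightarrow> complex^'b \<Rightarrow> complex^'c \<Rightarrow> real"
  proof -
    have "(\<integral>p. H (fst p) (fst (snd p)) (snd (snd p)) \<partial>M) = (\<integral>x. (\<integral>q. H x (fst q) (snd q) \<partial>(\<nu>2 \<Otimes>\<^sub>M \<nu>3)) \<partial>\<nu>1)"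
      unfolding M_def using H
      by (intro bdd_prob_fubini(1)[OF b(1) b23, of "\<lambda>x q. H x (fst q) (snd q)"]) (simp add: case_prod_beta')
    also have "(\<lambda>x. \<integral>q. H x (fst q) (snd q) \<partial>(\<nu>2 \<Otimes>\<^sub>M \<nu>3)) = (\<lambda>x. (\<integral>y. (\<integral>z. H x y z \<partial>\<nu>3) \<partial>\<nu>2))"
    proof
      fix x
      have "continuous_on UNIV (\<lambda>(y, z). H x y z)"
        using continuous_on_compose2[OF H, of UNIV "\<lambda>q. (x, q)"]
        by (simp add: case_prod_beta' continuous_intros)
      then show "(\<integral>q. H x (fst q) (snd q) \<partial>(\<nu>2 \<Otimes>\<^sub>M \<nu>3)) = (\<integral>y. (\<integral>z. H x y z \<partial>\<nu>3) \<partial>\<nu>2)"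
        by (intro bdd_prob_fubini(1) b)
    qed
    finally show ?thesis .
  qed
  let ?F = "\<lambda>u p. F u (fst p) (fst (snd p)) (snd (snd p))"
  have cF: "continuous_on UNIV (\<lambda>(u, p). ?F u p)" using F by (simp add: case_prod_beta')
  have "(\<integral>x. (\<integral>y. (\<integral>z. F u x y z \<partial>\<nu>3) \<partial>\<nu>2) \<partial>\<nu>1) = (\<integral>p. ?F u p \<partial>M)" for u
  proof (rule nested[symmetric])
    show "continuous_on UNIV (\<lambda>(x, y, z). F u x y z)"
      using continuous_on_compose2[OF F, of UNIV "\<lambda>q. (u, q)"]
      by (simp add: case_prod_beta' continuous_intros)
  qed
  then have "(\<integral>u. (\<integral>x. (\<integral>y. (\<integral>z. F u x y z \<partial>\<nu>3) \<partial>\<nu>2) \<partial>\<nu>1) \<partial>\<mu>) = (\<integral>u. (\<integral>p. ?F u p \<partial>M) \<partial>\<mu>)" by simp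
  also have "\<dots> = (\<integral>p. (\<integral>u. ?F u p \<partial>\<mu>) \<partial>M)"
    by (rule bdd_prob_fubini(2)[OF \<mu> bM cF, symmetric])
  also have "\<dots> = (\<integral>p. G (fst p) (fst (snd p)) (snd (snd p)) \<partial>M)"
  \<comment> \<open>The value \<open>G\<close> is known for unit vectors only, so the two integrands
    agree almost everywhere rather than pointwise.\<close>
  proof (rule integral_cong_AE)
    interpret \<mu>: prob_space \<mu> using \<mu> by (simp add: bdd_prob_def)
    interpret M: prob_space M using bM by (simp add: bdd_prob_def)
    interpret pair_prob_space \<mu> M ..
    show "(\<lambda>p. \<integral>u. ?F u p \<partial>\<mu>) \<in> borel_measurable M"
      by (intro borel_measurable_integrable integrable_snd bdd_prob_integrable[OF bdd_prob_pair[OF \<mu> bM]] cF)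
    show "(\<lambda>p. G (fst p) (fst (snd p)) (snd (snd p))) \<in> borel_measurable M"
      using G by (intro borel_measurable_integrable bdd_prob_integrable bM) (simp add: case_prod_beta')
    have n: "AE x in \<nu>1. norm x = 1" "AE x in \<nu>2. norm x = 1" "AE x in \<nu>3. norm x = 1"
      using \<nu> by (auto simp: orth_inv_states_def)
    have "AE q in \<nu>2 \<Otimes>\<^sub>M \<nu>3. norm (fst q) = 1 \<and> norm (snd q) = 1"
      by (rule AE_pair_closed[OF b(2,3) n(2,3)]) (intro closed_Collect_eq continuous_intros)+
    then have "AE p in M. norm (fst p) = 1 \<and> norm (fst (snd p)) = 1 \<and> norm (snd (snd p)) = 1"
      unfolding M_def
      by (rule AE_pair_closed[OF b(1) b23 n(1)]) (intro closed_Collect_eq closed_Collect_conj continuous_intros)+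
    then show "AE p in M. (\<integral>u. ?F u p \<partial>\<mu>) = G (fst p) (fst (snd p)) (snd (snd p))"
      by eventually_elim (auto intro!: eq)
  qed
  also have "\<dots> = (\<integral>x. (\<integral>y. (\<integral>z. G x y z \<partial>\<nu>3) \<partial>\<nu>2) \<partial>\<nu>1)"
    by (rule nested[OF G])
  finally show ?thesis .
qed

section \<open>The unitary and orthogonal means\<close>

theorem theorem3:
  fixes \<nu>1 :: "(complex^'a::finite) measure"
    and \<nu>2 :: "(complex^'b::finite) measure"
    and \<nu>3 :: "(complex^'c::finite) measure"
    and \<mu>U :: "(complex^('a \<times> 'b \<times> 'c)^('a \<times> 'b \<times> 'c)) measure"
    and \<mu>O :: "(real^('a \<times> 'b \<times> 'c)^('a \<times> 'b \<times> 'c)) measure"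
  assumes "unif_pure_states \<nu>1" "unif_pure_states \<nu>2" "unif_pure_states \<nu>3"
    and "haar_unitary \<mu>U" and "haar_orthogonal \<mu>O"
  defines "d1 \<equiv> real CARD('a)" and "d2 \<equiv> real CARD('b)" and "d3 \<equiv> real CARD('c)"
  defines "A \<equiv> 3 - d1 - d2 - d3 - d1*d2 - d1*d3 - d2*d3 + 3*d1*d2*d3"
  shows "(\<integral>U. ent_power \<nu>1 \<nu>2 \<nu>3 U \<partial>\<mu>U) = 2 * A / (3 * (d1*d2*d3 + 1)) \<and>
         (\<integral>Q. ent_power \<nu>1 \<nu>2 \<nu>3 (cmat_of_real Q) \<partial>\<mu>O) =
           2 * A * ((d1*(d1+1)) * (d2*(d2+1)) * (d3*(d3+1)) - 8) /
           (3 * (d1*d2*d3 - 1) * (d1*d2*d3 + 2) * ((d1+1)*(d2+1)*(d3+1)))"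
proof
  note o = assms(1-3)[THEN unif_pure_states_orth_inv]
  interpret \<nu>1: prob_space \<nu>1 using o by (simp add: orth_inv_states_def)
  interpret \<nu>2: prob_space \<nu>2 using o by (simp add: orth_inv_states_def)
  interpret \<nu>3: prob_space \<nu>3 using o by (simp add: orth_inv_states_def)
  \<comment> \<open>The unitary average is the same for every product state, so the state integrals
    run over a constant.\<close>
  have "(\<integral>U. ent_power \<nu>1 \<nu>2 \<nu>3 U \<partial>\<mu>U)
     = (\<integral>x. (\<integral>y. (\<integral>z. 2 * A / (3 * (d1*d2*d3 + 1)) \<partial>\<nu>3) \<partial>\<nu>2) \<partial>\<nu>1)"
    unfolding ent_power_def
  proof (rule average_swap[OF o haar_unitary_bdd[OF assms(4)]])
    show "continuous_on UNIV (\<lambda>(U :: complex^('a \<times> 'b \<times> 'c)^('a \<times> 'b \<times> 'c), x, y, z).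
        one_tangle (U *v prod_state x y z))"
      unfolding case_prod_beta' by (intro continuous_intros)
    fix x :: "complex^'a" and y :: "complex^'b" and z :: "complex^'c"
    assume "norm x = 1" "norm y = 1" "norm z = 1"
    then have n: "norm (prod_state x y z) = 1" by (rule norm_prod_state)
    have "(\<integral>U. one_tangle (U *v prod_state x y z) \<partial>\<mu>U)
      = (\<integral>\<psi>. one_tangle \<psi> \<partial>(distr \<mu>U borel (\<lambda>U. U *v prod_state x y z)))"
      using assms(4) by (intro borel_distr_integral[symmetric] continuous_intros) (simp add: haar_unitary_def)
    also have "\<dots> = 2 * A / (3 * (d1*d2*d3 + 1))"
      unfolding A_def d1_def d2_def d3_def
      by (rule unif_one_tangle_mean[OF haar_unitary_orbit[OF assms(4) n]])
    finally show "(\<integral>U. one_tangle (U *v prod_state x y z) \<partial>\<mu>U) = 2 * A / (3 * (d1*d2*d3 + 1))" .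
  qed simp
  then show "(\<integral>U. ent_power \<nu>1 \<nu>2 \<nu>3 U \<partial>\<mu>U) = 2 * A / (3 * (d1*d2*d3 + 1))"
    by (simp add: \<nu>1.prob_space \<nu>2.prob_space \<nu>3.prob_space)
next
  note o = assms(1-3)[THEN unif_pure_states_orth_inv]
  interpret \<nu>1: prob_space \<nu>1 using o by (simp add: orth_inv_states_def)
  interpret \<nu>2: prob_space \<nu>2 using o by (simp add: orth_inv_states_def)
  interpret \<nu>3: prob_space \<nu>3 using o by (simp add: orth_inv_states_def)
  \<comment> \<open>At a fixed product state the orthogonal average is \<open>K\<close> times
    \<open>N\<close> minus the overlap of that state; only the overlap depends on the state.\<close>
  define N K where "N = d1*d2*d3" and "K = 2 * A / (3 * (d1*d2*d3 - 1) * (d1*d2*d3 + 2))"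
  have i: "integrable \<nu>1 sq_overlap" "integrable \<nu>2 sq_overlap" "integrable \<nu>3 sq_overlap"
    by (intro bdd_prob_integrable orth_inv_states_bdd o continuous_intros)+
  have "(\<integral>Q. ent_power \<nu>1 \<nu>2 \<nu>3 (cmat_of_real Q) \<partial>\<mu>O)
     = (\<integral>x. (\<integral>y. (\<integral>z. K * (N - sq_overlap x * sq_overlap y * sq_overlap z) \<partial>\<nu>3) \<partial>\<nu>2) \<partial>\<nu>1)"
    unfolding ent_power_def
  proof (rule average_swap[OF o haar_orthogonal_bdd[OF assms(5)]])
    show "continuous_on UNIV (\<lambda>(Q :: real^('a \<times> 'b \<times> 'c)^('a \<times> 'b \<times> 'c), x, y, z).
        one_tangle (cmat_of_real Q *v prod_state x y z))"
      unfolding case_prod_beta' by (intro continuous_intros)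
    show "continuous_on UNIV (\<lambda>(x :: complex^'a, y :: complex^'b, z :: complex^'c).
        K * (N - sq_overlap x * sq_overlap y * sq_overlap z))"
      unfolding case_prod_beta' by (intro continuous_intros)
    fix x :: "complex^'a" and y :: "complex^'b" and z :: "complex^'c"
    assume "norm x = 1" "norm y = 1" "norm z = 1"
    then have n: "norm (prod_state x y z) = 1" by (rule norm_prod_state)
    let ?\<nu> = "distr \<mu>O borel (\<lambda>Q. cmat_of_real Q *v prod_state x y z)"
    have "(\<integral>Q. one_tangle (cmat_of_real Q *v prod_state x y z) \<partial>\<mu>O) = (\<integral>\<psi>. one_tangle \<psi> \<partial>?\<nu>)"
      using assms(5) by (intro borel_distr_integral[symmetric] continuous_intros) (simp add: haar_orthogonal_def)
    also have "\<dots> = K * (N - sq_overlap x * sq_overlap y * sq_overlap z)"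
      unfolding orth_inv_one_tangle_mean[OF haar_orthogonal_orbit(1)[OF assms(5) n]]
        haar_orthogonal_orbit(2)[OF assms(5) n] sq_overlap_prod_state
      by (simp add: K_def N_def A_def d1_def d2_def d3_def)
    finally show "(\<integral>Q. one_tangle (cmat_of_real Q *v prod_state x y z) \<partial>\<mu>O)
      = K * (N - sq_overlap x * sq_overlap y * sq_overlap z)" .
  qed
  \<comment> \<open>The overlap of a product state factorises and the three states are independent,
    so its mean is the product of the three means.\<close>
  also have "\<dots> = K * (N - (\<integral>x. sq_overlap x \<partial>\<nu>1) * (\<integral>x. sq_overlap x \<partial>\<nu>2) * (\<integral>x. sq_overlap x \<partial>\<nu>3))"
    using i by (simp add: \<nu>1.prob_space \<nu>2.prob_space \<nu>3.prob_space)
  also have "\<dots> = K * (N - 2 / (d1 + 1) * (2 / (d2 + 1)) * (2 / (d3 + 1)))"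
    unfolding assms(1-3)[THEN unif_sq_overlap] d1_def d2_def d3_def ..
  also have "N - 2 / (d1 + 1) * (2 / (d2 + 1)) * (2 / (d3 + 1))
     = ((d1*(d1+1)) * (d2*(d2+1)) * (d3*(d3+1)) - 8) / ((d1+1)*(d2+1)*(d3+1))"
  proof -
    have "d1 + 1 \<noteq> 0" "d2 + 1 \<noteq> 0" "d3 + 1 \<noteq> 0" by (simp_all add: d1_def d2_def d3_def add_nonneg_eq_0_iff)
    then show ?thesis unfolding N_def by (simp add: divide_simps)
  qed
  finally show "(\<integral>Q. ent_power \<nu>1 \<nu>2 \<nu>3 (cmat_of_real Q) \<partial>\<mu>O) =
           2 * A * ((d1*(d1+1)) * (d2*(d2+1)) * (d3*(d3+1)) - 8) /
           (3 * (d1*d2*d3 - 1) * (d1*d2*d3 + 2) * ((d1+1)*(d2+1)*(d3+1)))"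
    by (simp add: K_def)
qed

end
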